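(* Let $R$ be a Noetherian integral domain and let $G$ be an edge-labeled graph over $R$ in which every edge label is a principal ideal. If for every pair of distinct edge labels $I_i$ and $I_j$ we have $I_i+I_j=R$ (i.e. the edge schemes $\operatorname{Spec}(R/I_i)$ are pairwise disjoint), then $R_G$ is a projective $R$-module. If $R$ is a PID, or $R$ is of the form $A[x_1,\dots,x_n]$ with $A$ a PID or a field, then $R_G$ is also free.
   Context: An edge-labeled graph $G$ over $R$ is a finite graph $(V,E)$ with a map $\alpha$ from $E$ to the set of ideals of $R$. A spline is a function $s:V\to R$ with $s(u)-s(v)\in\alpha(e_{uv})$ for every edge $e_{uv}$ joining $u$ and $v$; the splines form a ring $R_G$ under pointwise operations, which is an $R$-module via constant splines. *)

theory Defs
  imports
    "HOL-Algebra.Indexed_Polynomials"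
    "HOL-Algebra.Ring_Divisibility"
    "Jordan_Normal_Form.Missing_VectorSpace"
begin

text \<open>Parallel edges and loops are allowed. A simple graph is the case in which \<open>ends\<close> is
  injective on \<open>E\<close> and every \<open>ends e\<close> has two elements.\<close>

locale edge_labeled_graph = cring R for R (structure) +
  fixes V :: "'v set" and E :: "'e set" and ends :: "'e \<Rightarrow> 'v set" and \<alpha> :: "'e \<Rightarrow> 'a set"
  assumes finite_V: "finite V"
    and finite_E: "finite E"
    and ends_edge: "e \<in> E \<Longrightarrow> \<exists>u\<in>V. \<exists>v\<in>V. ends e = {u, v}"
    and label_ideal: "e \<in> E \<Longrightarrow> ideal (\<alpha> e) R"

text \<open>Functions on \<open>V\<close> are represented extensionally (\<open>undefined\<close> outside \<open>V\<close>), so that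
  two splines are equal exactly when they agree on \<open>V\<close>. The record carries both the ring and the
  module structure; scalar multiplication by \<open>c\<close> is multiplication by the constant spline \<open>c\<close>.\<close>

definition splines ::
  "('a, 'm) ring_scheme \<Rightarrow> 'v set \<Rightarrow> 'e set \<Rightarrow> ('e \<Rightarrow> 'v set) \<Rightarrow> ('e \<Rightarrow> 'a set) \<Rightarrow> ('a, 'v \<Rightarrow> 'a) module"
  where "splines R V E ends \<alpha> =
    \<lparr>carrier = {s \<in> V \<rightarrow>\<^sub>E carrier R.
        \<forall>e\<in>E. \<forall>u\<in>V. \<forall>v\<in>V. ends e = {u, v} \<longrightarrow> s u \<ominus>\<^bsub>R\<^esub> s v \<in> \<alpha> e},
     monoid.mult = (\<lambda>s t. \<lambda>v\<in>V. s v \<otimes>\<^bsub>R\<^esub> t v),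
     one = (\<lambda>v\<in>V. \<one>\<^bsub>R\<^esub>),
     zero = (\<lambda>v\<in>V. \<zero>\<^bsub>R\<^esub>),
     add = (\<lambda>s t. \<lambda>v\<in>V. s v \<oplus>\<^bsub>R\<^esub> t v),
     smult = (\<lambda>c s. \<lambda>v\<in>V. c \<otimes>\<^bsub>R\<^esub> s v)\<rparr>"

definition free_module :: "('a, 'm) ring_scheme \<Rightarrow> ('a, 'b, 'n) module_scheme \<Rightarrow> bool"
  where "free_module R M \<longleftrightarrow> module R M \<and>
    (\<exists>B \<subseteq> carrier M. \<not> module.lin_dep R M B \<and> module.span R M B = carrier M)"

text \<open>Projective means direct summand of a free module. Fixing the type of the complement \<open>Q\<close> loses
  no generality: if \<open>P\<close> is projective, one can take for \<open>Q\<close> the kernel of the canonical surjection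
  onto \<open>P\<close> from the module of finitely supported functions \<open>carrier P \<rightarrow> carrier R\<close>.\<close>

definition projective_module :: "('a, 'm) ring_scheme \<Rightarrow> ('a, 'b, 'n) module_scheme \<Rightarrow> bool"
  where "projective_module R P \<longleftrightarrow> module R P \<and>
    (\<exists>Q :: ('a, 'b \<Rightarrow> 'a) module. module R Q \<and> free_module R (direct_sum P Q))"

text \<open>The polynomial ring \<open>A[x\<^sub>0, \<dots>, x\<^sub>n\<^sub>-\<^sub>1]\<close>. As in \<open>indexed_pset\<close>, a monomial is the multiset of its variables,
  and a polynomial maps a monomial to its coefficient; the product is convolution.\<close>

definition indexed_poly_ring :: "('a, 'm) ring_scheme \<Rightarrow> nat \<Rightarrow> (nat multiset \<Rightarrow> 'a) ring"
  where "indexed_poly_ring A n =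
    \<lparr>carrier = ring.indexed_pset A {..<n} (carrier A),
     monoid.mult = (\<lambda>P Q m. \<Oplus>\<^bsub>A\<^esub>k\<in>{k. k \<subseteq># m}. P k \<otimes>\<^bsub>A\<^esub> Q (m - k)),
     one = ring.indexed_const A \<one>\<^bsub>A\<^esub>,
     zero = ring.indexed_const A \<zero>\<^bsub>A\<^esub>,
     add = ring.indexed_padd A\<rparr>"

end

theory Submission
  imports Defs
begin

text \<open>The splines form a free module over any domain, so no theorem on projective modules over
  polynomial rings is needed. Enumerate the vertices as \<open>v\<^sub>0, \<dots>, v\<^sub>n\<^sub>-\<^sub>1\<close>. By the Chinese remainder
  theorem, the values at \<open>v\<^sub>k\<close> of the splines that vanish at \<open>v\<^sub>0, \<dots>, v\<^sub>k\<^sub>-\<^sub>1\<close> are exactly the elements of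
  the intersection of those labels \<open>I\<close> for which a path of edges labeled \<open>I\<close> joins \<open>v\<^sub>k\<close> to an earlier
  vertex. An intersection of pairwise comaximal principal ideals is principal, so choosing for every
  \<open>k\<close> a spline whose value at \<open>v\<^sub>k\<close> generates this ideal (and dropping those with value zero) gives a
  basis, as in the construction of the Hermite normal form.\<close>

section \<open>Comaximal ideals\<close>

context cring
begin

text \<open>Given \<open>i + j = 1\<close> with \<open>j\<close> in all earlier members and
  \<open>i' + j' = 1\<close> for the new ideal, expanding \<open>j\<close> as
  \<open>j * (i' + j')\<close> gives the next decomposition. \<open>j \<in> carrier R\<close> is
  stated separately because the intersection of the empty family is the whole type.\<close>

lemma comaximal_Inter:
  assumes "finite A" "ideal I R" "\<And>J. J \<in> A \<Longrightarrow> ideal J R" "\<And>J. J \<in> A \<Longrightarrow> I <+> J = carrier R"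
  shows "\<exists>i\<in>I. \<exists>j\<in>carrier R. j \<in> \<Inter>A \<and> i \<oplus> j = \<one>"
  using assms(1,3,4)
proof (induction A rule: finite_induct)
  case empty
  have "\<zero> \<in> I" using assms(2) by (simp add: additive_subgroup.zero_closed ideal.axioms(1))
  then show ?case by force
next
  case (insert J A)
  interpret I: ideal I R by fact
  interpret J: ideal J R by (simp add: insert.prems(1))
  obtain i j where ij: "i \<in> I" "j \<in> carrier R" "j \<in> \<Inter>A" "i \<oplus> j = \<one>"
    using insert.IH insert.prems by auto
  have "\<one> \<in> I <+> J" using insert.prems(2) by simp
  then obtain i' j' where ij': "i' \<in> I" "j' \<in> J" "i' \<oplus> j' = \<one>"
    by (auto simp: set_add_def')
  have c: "i \<in> carrier R" "i' \<in> carrier R" "j' \<in> carrier R"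
    using ij ij' I.Icarr J.Icarr by auto
  have "(i \<oplus> j \<otimes> i') \<oplus> j \<otimes> j' = i \<oplus> j \<otimes> (i' \<oplus> j')"
    using c ij(2) by algebra
  then have "(i \<oplus> j \<otimes> i') \<oplus> j \<otimes> j' = \<one>"
    using ij' ij c by simp
  moreover have "i \<oplus> j \<otimes> i' \<in> I" using ij ij' by (simp add: I.I_l_closed)
  moreover have "j \<otimes> j' \<in> \<Inter>(insert J A)"
    using ij ij' c insert.prems(1) by (auto intro: J.I_l_closed ideal.I_r_closed)
  ultimately show ?case using c ij(2) by (metis m_closed)
qed

lemma chinese_remainder_family:
  assumes "finite A" "\<And>I. I \<in> A \<Longrightarrow> ideal I R"
    and "\<And>I J. I \<in> A \<Longrightarrow> J \<in> A \<Longrightarrow> I \<noteq> J \<Longrightarrow> I <+> J = carrier R"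
    and "f \<in> A \<rightarrow> carrier R"
  shows "\<exists>x\<in>carrier R. \<forall>I\<in>A. x \<ominus> f I \<in> I"
  using assms
proof (induction A rule: finite_induct)
  case empty
  then show ?case by blast
next
  case (insert I A)
  interpret I: ideal I R by (simp add: insert.prems(1))
  obtain x where x: "x \<in> carrier R" "\<forall>J\<in>A. x \<ominus> f J \<in> J"
    using insert.IH insert.prems by auto
  obtain i j where ij: "i \<in> I" "j \<in> carrier R" "j \<in> \<Inter>A" "i \<oplus> j = \<one>"
    using comaximal_Inter[of A I] insert.hyps insert.prems by (metis I.is_ideal insertCI)
  have c: "i \<in> carrier R" "f I \<in> carrier R" using ij I.Icarr insert.prems(3) by auto
  have "i = (i \<oplus> j) \<ominus> j" using ij(2) c by algebra
  \<comment> \<open>Eliminating \<open>i\<close> turns the two congruences below into plain ring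
    identities.\<close>
  then have i: "i = \<one> \<ominus> j" using ij(4) by simp
  \<comment> \<open>\<open>i\<close> is 0 modulo \<open>I\<close> and 1 modulo every member of
    \<open>A\<close>, and \<open>j\<close> is the reverse, so \<open>y\<close> interpolates between
    \<open>f I\<close> and the earlier solution \<open>x\<close>.\<close>
  define y where "y = x \<otimes> i \<oplus> f I \<otimes> j"
  have y: "y \<in> carrier R" using x ij c by (simp add: y_def)
  have "y \<ominus> f I = (x \<ominus> f I) \<otimes> i"
    unfolding y_def i using x(1) ij(2) c by algebra
  then have "y \<ominus> f I \<in> I" using x ij c by (simp add: I.I_l_closed)
  moreover have "y \<ominus> f J \<in> J" if J: "J \<in> A" for J
  proof -
    interpret J: ideal J R by (simp add: insert.prems(1) J)
    have fJ: "f J \<in> carrier R" using J insert.prems(3) by auto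
    have "y \<ominus> f J = (x \<ominus> f J) \<oplus> (f I \<ominus> x) \<otimes> j"
      unfolding y_def i using x(1) ij(2) c fJ by algebra
    then show ?thesis
      using x J ij c by (simp add: J.I_l_closed)
  qed
  ultimately show ?case using y by blast
qed

text \<open>If \<open>a\<close> and \<open>c\<close> generate comaximal ideals, these meet in the
  ideal generated by \<open>a \<otimes> c\<close>; induction extends this to finite families.
  Intersecting with \<open>carrier R\<close> makes the empty family yield the unit ideal.\<close>

lemma principalideal_Inter_comaximal:
  assumes "finite A" "\<And>I. I \<in> A \<Longrightarrow> principalideal I R"
    and "\<And>I J. I \<in> A \<Longrightarrow> J \<in> A \<Longrightarrow> I \<noteq> J \<Longrightarrow> I <+> J = carrier R"
  shows "\<exists>c\<in>carrier R. carrier R \<inter> \<Inter>A = PIdl c"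
  using assms
proof (induction A rule: finite_induct)
  case empty
  then show ?case by (force simp: cgenideal_def intro!: bexI[of _ \<one>])
next
  case (insert I A)
  interpret I: principalideal I R by (simp add: insert.prems(1))
  have id: "ideal J R" if "J \<in> A" for J
    using insert.prems(1)[of J] that by (simp add: principalideal_def)
  obtain c where c: "c \<in> carrier R" "carrier R \<inter> \<Inter>A = PIdl c"
    using insert.IH insert.prems by auto
  obtain a where a: "a \<in> carrier R" "I = PIdl a"
    using I.generate by (auto simp: cgenideal_eq_genideal)
  obtain i j where ij: "i \<in> I" "j \<in> carrier R" "j \<in> \<Inter>A" "i \<oplus> j = \<one>"
    using comaximal_Inter[of A I] id insert.hyps insert.prems by (metis I.is_ideal insertCI)
  have "j \<in> PIdl c" using ij c by blast
  then obtain s where s: "s \<in> carrier R" "j = s \<otimes> c" by (auto simp: cgenideal_def)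
  obtain t where t: "t \<in> carrier R" "i = t \<otimes> a"
    using ij(1) unfolding a(2) cgenideal_def by blast
  have "carrier R \<inter> \<Inter>(insert I A) = I \<inter> (carrier R \<inter> \<Inter>A)"
    by blast
  also have "\<dots> = PIdl a \<inter> PIdl c"
    by (simp only: a(2) c(2))
  also have "\<dots> = PIdl (a \<otimes> c)"
  proof (rule equalityI; rule subsetI)
    fix x assume "x \<in> PIdl a \<inter> PIdl c"
    then obtain u w where u: "u \<in> carrier R" "x = u \<otimes> a" and w: "w \<in> carrier R" "x = w \<otimes> c"
      by (auto simp: cgenideal_def)
    have x: "x \<in> carrier R" using u a by simp
    \<comment> \<open>Since \<open>i\<close> is a multiple of \<open>a\<close> and \<open>x\<close>
      one of \<open>c\<close>, \<open>x \<otimes> i\<close> is a multiple of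
      \<open>a \<otimes> c\<close>; the other summand is treated with the roles exchanged.\<close>
    have "x = x \<otimes> (i \<oplus> j)" using x ij by simp
    also have "\<dots> = x \<otimes> i \<oplus> x \<otimes> j" using x s t a c by algebra
    also have "x \<otimes> i = (w \<otimes> t) \<otimes> (a \<otimes> c)" unfolding w(2) t(2) using w t a c by algebra
    also have "x \<otimes> j = (u \<otimes> s) \<otimes> (a \<otimes> c)" unfolding u(2) s(2) using u s a c by algebra
    also have "(w \<otimes> t) \<otimes> (a \<otimes> c) \<oplus> (u \<otimes> s) \<otimes> (a \<otimes> c) = (w \<otimes> t \<oplus> u \<otimes> s) \<otimes> (a \<otimes> c)"
      using u w s t a c by algebra
    finally show "x \<in> PIdl (a \<otimes> c)"
      using u w s t by (auto simp: cgenideal_def)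
  next
    fix x assume "x \<in> PIdl (a \<otimes> c)"
    then obtain u where u: "u \<in> carrier R" "x = u \<otimes> (a \<otimes> c)" by (auto simp: cgenideal_def)
    have "x = (u \<otimes> c) \<otimes> a" "x = (u \<otimes> a) \<otimes> c" unfolding u(2) using u a c by algebra+
    then show "x \<in> PIdl a \<inter> PIdl c" unfolding cgenideal_def using u a c by blast
  qed
  finally show ?case using a c by blast
qed

end

section \<open>Free modules\<close>

text \<open>Echelon form: the coordinates \<phi> embed \<open>M\<close> into the n-tuples over
  \<open>R\<close>. Elements whose first \<open>k\<close> coordinates vanish and whose coordinate
  \<open>k\<close> generates the leading ideal form a triangular system. Independence follows
  because \<open>R\<close> is a domain, spanning by clearing one coordinate after another.\<close>

lemma free_module_of_leading_ideals:
  fixes R :: "('a, 'm) ring_scheme" (structure) and M :: "('a, 'b, 'n) module_scheme"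
    and \<phi> :: "nat \<Rightarrow> 'b \<Rightarrow> 'a"
  assumes "domain R" and "module R M"
    and closed: "\<And>k x. k < n \<Longrightarrow> x \<in> carrier M \<Longrightarrow> \<phi> k x \<in> carrier R"
    and add: "\<And>k x y. k < n \<Longrightarrow> x \<in> carrier M \<Longrightarrow> y \<in> carrier M \<Longrightarrow>
      \<phi> k (x \<oplus>\<^bsub>M\<^esub> y) = \<phi> k x \<oplus> \<phi> k y"
    and smult: "\<And>k r x. k < n \<Longrightarrow> r \<in> carrier R \<Longrightarrow> x \<in> carrier M \<Longrightarrow>
      \<phi> k (r \<odot>\<^bsub>M\<^esub> x) = r \<otimes> \<phi> k x"
    and inj: "\<And>x. x \<in> carrier M \<Longrightarrow> (\<And>k. k < n \<Longrightarrow> \<phi> k x = \<zero>) \<Longrightarrow> x = \<zero>\<^bsub>M\<^esub>"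
    and lead: "\<And>k. k < n \<Longrightarrow>
      \<exists>c\<in>carrier R. \<phi> k ` {x \<in> carrier M. \<forall>j<k. \<phi> j x = \<zero>} = PIdl c"
  shows "free_module R M"
proof -
  interpret R: domain R by fact
  interpret M: module R M by fact
  have phi0: "\<phi> k \<zero>\<^bsub>M\<^esub> = \<zero>" if "k < n" for k
    using smult[OF that, of \<zero> "\<zero>\<^bsub>M\<^esub>"] closed[OF that, of "\<zero>\<^bsub>M\<^esub>"] by simp
  have phi_finsum: "\<phi> k (\<Oplus>\<^bsub>M\<^esub>v\<in>A. f v) = (\<Oplus>v\<in>A. \<phi> k (f v))"
    if "k < n" "finite A" "f \<in> A \<rightarrow> carrier M" for k A f
    using that(2,3)
  proof (induction A rule: finite_induct)
    case empty
    then show ?case by (simp add: phi0 that)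
  next
    case (insert v A)
    then have "f v \<in> carrier M" "f \<in> A \<rightarrow> carrier M" by auto
    moreover from this have "(\<lambda>v. \<phi> k (f v)) \<in> A \<rightarrow> carrier R" using closed[OF that(1)] by auto
    ultimately show ?case
      using insert by (simp add: add[OF that(1)] closed[OF that(1)])
  qed
  have ex: "\<exists>b. b \<in> carrier M \<and> (\<forall>j<k. \<phi> j b = \<zero>) \<and>
      \<phi> k ` {x \<in> carrier M. \<forall>j<k. \<phi> j x = \<zero>} = PIdl (\<phi> k b)" if k: "k < n" for k
  proof -
    obtain c where c: "c \<in> carrier R" "\<phi> k ` {x \<in> carrier M. \<forall>j<k. \<phi> j x = \<zero>} = PIdl c"
      using lead[OF k] by blast
    \<comment> \<open>A generator lies in its own ideal, hence is attained as a coordinate; an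
      element attaining it serves as \<open>b k\<close>.\<close>
    then have "c \<in> \<phi> k ` {x \<in> carrier M. \<forall>j<k. \<phi> j x = \<zero>}"
      by (simp add: R.cgenideal_self)
    then show ?thesis using c by force
  qed
  have "\<exists>b. \<forall>k. k < n \<longrightarrow> b k \<in> carrier M \<and> (\<forall>j<k. \<phi> j (b k) = \<zero>) \<and>
      \<phi> k ` {x \<in> carrier M. \<forall>j<k. \<phi> j x = \<zero>} = PIdl (\<phi> k (b k))"
    by (rule choice) (use ex in blast)
  then obtain b where "\<forall>k. k < n \<longrightarrow> b k \<in> carrier M \<and> (\<forall>j<k. \<phi> j (b k) = \<zero>) \<and>
      \<phi> k ` {x \<in> carrier M. \<forall>j<k. \<phi> j x = \<zero>} = PIdl (\<phi> k (b k))"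
    by (rule exE)
  then have b: "\<And>k. k < n \<Longrightarrow> b k \<in> carrier M" "\<And>j k. k < n \<Longrightarrow> j < k \<Longrightarrow> \<phi> j (b k) = \<zero>"
    "\<And>k. k < n \<Longrightarrow> \<phi> k ` {x \<in> carrier M. \<forall>j<k. \<phi> j x = \<zero>} = PIdl (\<phi> k (b k))"
    by simp_all
  define W where "W = {k. k < n \<and> \<phi> k (b k) \<noteq> \<zero>}"
  have sub: "b ` W \<subseteq> carrier M" using b(1) by (auto simp: W_def)
  interpret sp: submodule R "M.span (b ` W)" M
    using sub by (rule M.span_is_submodule)
  have "\<not> M.lin_dep (b ` W)"
  proof
    assume "M.lin_dep (b ` W)"
    then obtain A a v where A: "finite A" "A \<subseteq> b ` W" "a \<in> A \<rightarrow> carrier R"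
      "M.lincomb a A = \<zero>\<^bsub>M\<^esub>" "v \<in> A" "a v \<noteq> \<zero>"
      unfolding M.lin_dep_def by blast
    \<comment> \<open>The least index with a nonzero coefficient is chosen so that applying
      \<open>\<phi> k\<close> to the relation isolates a single term.\<close>
    define P where "P = (\<lambda>k. k \<in> W \<and> b k \<in> A \<and> a (b k) \<noteq> \<zero>)"
    define k where "k = (LEAST k. P k)"
    have "\<exists>k. P k" using A unfolding P_def by blast
    then have Pk: "P k" unfolding k_def by (rule LeastI_ex)
    have min: "\<not> P j" if "j < k" for j using that not_less_Least unfolding k_def by blast
    have kn: "k < n" and bk: "\<phi> k (b k) \<noteq> \<zero>" using Pk by (auto simp: P_def W_def)
    have AM: "\<And>w. w \<in> A \<Longrightarrow> w \<in> carrier M" using A sub by blast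
    have aR: "\<And>w. w \<in> A \<Longrightarrow> a w \<in> carrier R" using A by auto
    have "\<phi> k (M.lincomb a A) = (\<Oplus>w\<in>A. \<phi> k (a w \<odot>\<^bsub>M\<^esub> w))"
      unfolding M.lincomb_def using AM aR by (intro phi_finsum kn A) auto
    also have "\<dots> = (\<Oplus>w\<in>A. if b k = w then a w \<otimes> \<phi> k w else \<zero>)"
    proof (rule R.finsum_cong')
      fix w assume w: "w \<in> A"
      then obtain j where j: "j \<in> W" "w = b j" using A by blast
      have jn: "j < n" using j by (simp add: W_def)
      show "\<phi> k (a w \<odot>\<^bsub>M\<^esub> w) = (if b k = w then a w \<otimes> \<phi> k w else \<zero>)"
      \<comment> \<open>For \<open>j < k\<close> the coefficient vanishes by minimality of
        \<open>k\<close>; for \<open>j > k\<close> the coordinate \<open>k\<close> of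
        \<open>b j\<close> vanishes. In both cases the two branches of the conditional are
        zero.\<close>
      proof (cases j k rule: linorder_cases)
        case less
        then have "a w = \<zero>" using min j w by (auto simp: P_def)
        then show ?thesis using w AM closed[OF kn] by (simp add: phi0[OF kn])
      next
        case equal
        then show ?thesis using w AM aR j by (simp add: smult[OF kn])
      next
        case greater
        then have "\<phi> k w = \<zero>" using b(2)[OF jn] j by simp
        then show ?thesis using w AM aR by (simp add: smult[OF kn])
      qed
    qed (use AM aR closed[OF kn] in auto)
    also have "\<dots> = a (b k) \<otimes> \<phi> k (b k)"
      using Pk AM aR closed[OF kn] A(1) by (intro R.add.finprod_singleton) (auto simp: P_def)
    finally have "a (b k) \<otimes> \<phi> k (b k) = \<zero>" using A phi0[OF kn] by simp
    then show False
      using Pk aR bk closed[OF kn b(1)[OF kn]] R.integral by (auto simp: P_def)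
  qed
  \<comment> \<open>Downward induction on the number \<open>k\<close> of vanishing leading
    coordinates: at \<open>k = n\<close> joint injectivity forces \<open>x\<close> to be zero, and
    \<open>k = 0\<close> imposes no condition.\<close>
  moreover have "x \<in> M.span (b ` W)"
    if "x \<in> carrier M" "\<forall>j<k. \<phi> j x = \<zero>" "k \<le> n" for x k
    using that(3,1,2)
  proof (induction k arbitrary: x rule: inc_induct)
    case base
    then have "x = \<zero>\<^bsub>M\<^esub>" by (intro inj) auto
    then show ?case
      using sp.zero_closed by simp
  next
    case (step k)
    have kn: "k < n" by fact
    have "\<phi> k x \<in> PIdl (\<phi> k (b k))" unfolding b(3)[OF kn, symmetric] using step.prems by blast
    then obtain r where r: "r \<in> carrier R" "\<phi> k x = r \<otimes> \<phi> k (b k)"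
      by (auto simp: cgenideal_def)
    show ?case
    proof (cases "\<phi> k (b k) = \<zero>")
      case True
      then show ?thesis using step r by (metis R.r_null less_Suc_eq)
    next
      case False
      \<comment> \<open>Subtracting \<open>r\<close> times \<open>b k\<close> clears coordinate
        \<open>k\<close>; the earlier ones stay zero because \<open>b k\<close> vanishes
        there.\<close>
      let ?y = "x \<oplus>\<^bsub>M\<^esub> (\<ominus> r) \<odot>\<^bsub>M\<^esub> b k"
      have y: "?y \<in> carrier M" using step.prems b(1)[OF kn] r by simp
      have "\<phi> j ?y = \<zero>" if "j < Suc k" for j
      proof -
        have jn: "j < n" using that kn by simp
        have "\<phi> j ?y = \<phi> j x \<oplus> (\<ominus> r) \<otimes> \<phi> j (b k)"
          using step.prems b(1)[OF kn] r by (simp add: add[OF jn] smult[OF jn])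
        then show ?thesis
          using r step.prems(2) b(1,2)[OF kn] closed[OF kn] that
          by (cases "j = k") (auto simp: R.l_minus R.r_neg)
      qed
      then have 1: "?y \<in> M.span (b ` W)" using step.IH y by blast
      have "b k \<in> M.span (b ` W)"
        using M.in_own_span[OF sub] False kn by (auto simp: W_def)
      then have 2: "r \<odot>\<^bsub>M\<^esub> b k \<in> M.span (b ` W)"
        using r by simp
      have "?y \<oplus>\<^bsub>M\<^esub> r \<odot>\<^bsub>M\<^esub> b k = x"
        using step.prems(1) b(1)[OF kn] r
        by (simp add: M.smult_l_minus M.M.a_assoc M.M.l_neg)
      then show ?thesis
        using sp.m_closed[OF 1 2] by simp
    qed
  qed
  from this[of _ 0] have "M.span (b ` W) = carrier M"
    using M.span_is_subset2[OF sub] by auto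
  ultimately show ?thesis using sub M.module_axioms by (auto simp: free_module_def)
qed

section \<open>Transport of bases along isomorphisms\<close>

lemma (in mod_hom) lincomb_image:
  assumes "finite A" "A \<subseteq> carrier M" "inj_on f A" "a \<in> f ` A \<rightarrow> carrier R"
  shows "N.lincomb a (f ` A) = f (M.lincomb (a \<circ> f) A)"
proof -
  have "N.lincomb a (f ` A) = (\<Oplus>\<^bsub>N\<^esub>v\<in>A. a (f v) \<odot>\<^bsub>N\<^esub> f v)"
    unfolding N.lincomb_def using assms by (subst N.M.add.finprod_reindex) auto
  also have "\<dots> = (\<Oplus>\<^bsub>N\<^esub>v\<in>A. f (a (f v) \<odot>\<^bsub>M\<^esub> v))"
    using assms by (intro N.M.finsum_cong') (auto simp: Pi_iff subset_iff)
  also have "\<dots> = f (M.lincomb (a \<circ> f) A)"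
    unfolding M.lincomb_def using assms by (subst hom_sum) (auto simp: Pi_iff subset_iff)
  finally show ?thesis .
qed

text \<open>The image of a basis is a basis: relations among images pull back by injectivity, and
  linear combinations push forward.\<close>

lemma free_module_iso:
  assumes "free_module R M" "mod_hom R M N f" "bij_betw f (carrier M) (carrier N)"
  shows "free_module R N"
proof -
  interpret mod_hom R M N f by fact
  obtain B where B: "B \<subseteq> carrier M" "\<not> M.lin_dep B" "M.span B = carrier M"
    using assms(1) by (auto simp: free_module_def)
  have inj: "inj_on f (carrier M)" and im: "f ` carrier M = carrier N"
    using assms(3) by (auto simp: bij_betw_def)
  have "\<not> N.lin_dep (f ` B)"
  proof
    assume "N.lin_dep (f ` B)"
    then obtain A' a v where A': "finite A'" "A' \<subseteq> f ` B" "a \<in> A' \<rightarrow> carrier R"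
      "N.lincomb a A' = \<zero>\<^bsub>N\<^esub>" "v \<in> A'" "a v \<noteq> \<zero>\<^bsub>R\<^esub>"
      unfolding N.lin_dep_def by blast
    then obtain A where A: "A \<subseteq> B" "finite A" "A' = f ` A"
      by (meson finite_subset_image)
    have AM: "A \<subseteq> carrier M" using A B by blast
    have "f (M.lincomb (a \<circ> f) A) = f \<zero>\<^bsub>M\<^esub>"
      using lincomb_image[of A a] A A' AM inj_on_subset[OF inj] by auto
    moreover have "M.lincomb (a \<circ> f) A \<in> carrier M"
      using A A' AM by (intro M.lincomb_closed) auto
    ultimately have "M.lincomb (a \<circ> f) A = \<zero>\<^bsub>M\<^esub>"
      using inj_onD[OF inj] M.M.zero_closed by blast
    moreover obtain w where "w \<in> A" "v = f w" using A A' by blast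
    ultimately have "M.lin_dep B"
      using A A' by (intro M.lin_dep_crit[of A B "a \<circ> f" w]) auto
    then show False using B by blast
  qed
  moreover have "carrier N \<subseteq> N.span (f ` B)"
  proof
    fix y assume "y \<in> carrier N"
    then obtain x where x: "x \<in> carrier M" "y = f x" using im by blast
    then obtain A a where A: "finite A" "A \<subseteq> B" "a \<in> A \<rightarrow> carrier R" "x = M.lincomb a A"
      unfolding B(3)[symmetric] M.span_def by blast
    have AM: "A \<subseteq> carrier M" using A B by blast
    define g where "g = the_inv_into A f"
    have injA: "inj_on f A" using inj AM by (rule inj_on_subset)
    have g: "g (f v) = v" if "v \<in> A" for v
      using that injA by (simp add: g_def the_inv_into_f_f)
    have "N.lincomb (a \<circ> g) (f ` A) = f (M.lincomb (a \<circ> g \<circ> f) A)"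
      using A AM injA g by (intro lincomb_image) auto
    also have "M.lincomb (a \<circ> g \<circ> f) A = M.lincomb a A"
      unfolding M.lincomb_def using A AM g
      by (intro M.M.finsum_cong') (auto simp: Pi_iff subset_iff)
    finally have "y = N.lincomb (a \<circ> g) (f ` A)" using x(2) A(4) by metis
    moreover have "a \<circ> g \<in> f ` A \<rightarrow> carrier R" using A g by auto
    ultimately show "y \<in> N.span (f ` B)"
      using A unfolding N.span_def by blast
  qed
  moreover have "f ` B \<subseteq> carrier N" using B by auto
  ultimately show ?thesis
    using N.span_is_subset2[of "f ` B"] N.module_axioms by (auto simp: free_module_def)
qed

lemma free_imp_projective:
  fixes R :: "('a, 'm) ring_scheme" and M :: "('a, 'b, 'n) module_scheme"
  assumes "free_module R M"
  shows "projective_module R M"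
proof -
  interpret M: module R M using assms by (simp add: free_module_def)
  \<comment> \<open>The complement is the zero module. Its type has no distinguished element, so
    \<open>undefined\<close> serves as the single point.\<close>
  define Q :: "('a, 'b \<Rightarrow> 'a) module" where
    "Q = \<lparr>carrier = {undefined}, monoid.mult = (\<lambda>_ _. undefined), one = undefined,
      zero = undefined, add = (\<lambda>_ _. undefined), smult = (\<lambda>_ _. undefined)\<rparr>"
  have "abelian_group Q"
    by (rule abelian_groupI) (auto simp: Q_def)
  then have Q: "module R Q"
    by (intro moduleI M.R.cring_axioms) (auto simp: Q_def)
  have DS: "module R (direct_sum M Q)"
    using M.module_axioms Q by (rule direct_sum_is_module)
  have "mod_hom R M (direct_sum M Q) (\<lambda>x. (x, undefined))"
    using M.module_axioms DS
    by (auto simp: mod_hom_def mod_hom_axioms_def module_hom_def direct_sum_def Q_def)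
  moreover have "bij_betw (\<lambda>x. (x, undefined)) (carrier M) (carrier (direct_sum M Q))"
    by (auto simp: bij_betw_def inj_on_def direct_sum_def Q_def)
  ultimately have "free_module R (direct_sum M Q)"
    using assms by (rule free_module_iso[rotated])
  then show ?thesis
    using Q M.module_axioms by (auto simp: projective_module_def)
qed

section \<open>Splines\<close>

context edge_labeled_graph
begin

lemma splines_module: "module R (splines R V E ends \<alpha>)"
proof -
  let ?S = "splines R V E ends \<alpha>"
  have add: "(s u \<oplus> t u) \<ominus> (s v \<oplus> t v) \<in> \<alpha> e"
    if "e \<in> E" "s u \<ominus> s v \<in> \<alpha> e" "t u \<ominus> t v \<in> \<alpha> e"
      "s u \<in> carrier R" "s v \<in> carrier R" "t u \<in> carrier R" "t v \<in> carrier R" for e s t u v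
  proof -
    interpret ideal "\<alpha> e" R using label_ideal that(1) .
    have "(s u \<oplus> t u) \<ominus> (s v \<oplus> t v) = (s u \<ominus> s v) \<oplus> (t u \<ominus> t v)"
      using that(4-) by algebra
    then show ?thesis using that by simp
  qed
  have scale: "(c \<otimes> s u) \<ominus> (c \<otimes> s v) \<in> \<alpha> e"
    if "e \<in> E" "s u \<ominus> s v \<in> \<alpha> e" "s u \<in> carrier R" "s v \<in> carrier R" "c \<in> carrier R" for e s u v c
  proof -
    interpret ideal "\<alpha> e" R using label_ideal that(1) .
    have "(c \<otimes> s u) \<ominus> (c \<otimes> s v) = c \<otimes> (s u \<ominus> s v)"
      using that(3-) by algebra
    then show ?thesis using that by (simp add: I_l_closed)
  qed
  have zero: "\<zero> \<ominus> \<zero> \<in> \<alpha> e" if "e \<in> E" for e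
    using label_ideal[OF that]
    by (simp add: additive_subgroup.zero_closed ideal.axioms(1) a_minus_def)
  have smult_S: "c \<odot>\<^bsub>?S\<^esub> s \<in> carrier ?S" if "c \<in> carrier R" "s \<in> carrier ?S" for c s
    using that by (auto simp: splines_def intro!: scale)
  have "abelian_group ?S"
  proof (rule abelian_groupI)
    fix s assume s: "s \<in> carrier ?S"
    show "\<exists>t\<in>carrier ?S. t \<oplus>\<^bsub>?S\<^esub> s = \<zero>\<^bsub>?S\<^esub>"
    proof
      \<comment> \<open>Taking the negative as a scalar multiple reduces the edge condition to
        closure under scaling.\<close>
      show "(\<ominus> \<one>) \<odot>\<^bsub>?S\<^esub> s \<in> carrier ?S" using s by (simp add: smult_S)
      show "(\<ominus> \<one>) \<odot>\<^bsub>?S\<^esub> s \<oplus>\<^bsub>?S\<^esub> s = \<zero>\<^bsub>?S\<^esub>"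
        using s by (auto simp: splines_def fun_eq_iff PiE_iff l_minus l_neg)
    qed
  next
    fix s t assume "s \<in> carrier ?S" "t \<in> carrier ?S"
    then show "s \<oplus>\<^bsub>?S\<^esub> t \<in> carrier ?S"
      by (auto simp: splines_def intro!: add)
  qed (auto simp: splines_def fun_eq_iff PiE_iff zero a_ac extensional_def)
  then show ?thesis
    using smult_S cring_axioms
    by (intro moduleI)
      (auto simp: splines_def fun_eq_iff PiE_iff l_distr r_distr m_assoc extensional_def)
qed

text \<open>Indexed by ideals rather than edges, so all edges with equal labels act together:
  \<open>(step I)\<^sup>*\<close> is connectivity in the subgraph of edges labeled \<open>I\<close>.
  It is symmetric because \<open>ends\<close> is unordered.\<close>

definition step :: "'a set \<Rightarrow> ('v \<times> 'v) set"
  where "step I = {(u, v). u \<in> V \<and> v \<in> V \<and> (\<exists>e\<in>E. \<alpha> e = I \<and> ends e = {u, v})}"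

text \<open>Differences telescope along the path. The condition \<open>u \<in> V\<close> covers the
  empty path, since the reflexive closure also relates points outside \<open>V\<close> to
  themselves.\<close>

lemma spline_const_mod:
  assumes "s \<in> carrier (splines R V E ends \<alpha>)" "(u, v) \<in> (step I)\<^sup>*" "u \<in> V" "I \<in> \<alpha> ` E"
  shows "s u \<ominus> s v \<in> I"
proof -
  interpret ideal I R using assms label_ideal by blast
  have carr: "s w \<in> carrier R" if "w \<in> V" for w
    using assms(1) that by (auto simp: splines_def)
  from assms(2) have "v \<in> V \<and> s u \<ominus> s v \<in> I"
  proof (induction rule: rtrancl_induct)
    case base
    then show ?case using assms(3) carr by (simp add: a_minus_def r_neg)
  next
    case (step v w)
    have w: "w \<in> V" and "s v \<ominus> s w \<in> I"
      using step.hyps(2) assms(1) by (auto simp: step_def splines_def)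
    moreover have "s u \<ominus> s w = (s u \<ominus> s v) \<oplus> (s v \<ominus> s w)"
      using carr assms(3) w step.IH by algebra
    ultimately show ?case using step.IH by simp
  qed
  then show ?thesis ..
qed

text \<open>A spline vanishing at an earlier vertex joined to \<open>v k\<close> by edges labeled
  \<open>I\<close> has its value at \<open>v k\<close> in \<open>I\<close>. Conversely, residues
  constant on the \<open>I\<close>-components are prescribed for every label \<open>I\<close> and
  glued at each vertex by the Chinese remainder theorem.\<close>

lemma leading_ideal:
  fixes v :: "nat \<Rightarrow> 'v"
  assumes enum: "bij_betw v {..<n} V" and k: "k < n"
    and comax: "\<And>I J. I \<in> \<alpha> ` E \<Longrightarrow> J \<in> \<alpha> ` E \<Longrightarrow> I \<noteq> J \<Longrightarrow> I <+> J = carrier R"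
  shows "(\<lambda>s. s (v k)) ` {s \<in> carrier (splines R V E ends \<alpha>). \<forall>j<k. s (v j) = \<zero>} =
    carrier R \<inter> \<Inter>{I \<in> \<alpha> ` E. \<exists>j<k. (v j, v k) \<in> (step I)\<^sup>*}" (is "?L = carrier R \<inter> \<Inter>?A")
proof -
  have vV: "v j \<in> V" if "j < n" for j using enum that by (auto simp: bij_betw_def)
  show ?thesis
  proof (intro equalityI subsetI)
    fix c assume "c \<in> ?L"
    then obtain s where s: "s \<in> carrier (splines R V E ends \<alpha>)" "\<forall>j<k. s (v j) = \<zero>" "c = s (v k)"
      by auto
    have c: "c \<in> carrier R" using s vV[OF k] by (auto simp: splines_def)
    have "c \<in> I" if I: "I \<in> \<alpha> ` E" "(v j, v k) \<in> (step I)\<^sup>*" "j < k" for I j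
    proof -
      interpret ideal I R using I label_ideal by blast
      have "j < n" using I(3) k by simp
      then have "\<zero> \<ominus> c \<in> I" using spline_const_mod[OF s(1) I(2) vV I(1)] s(2,3) I(3) by simp
      then have "\<ominus> (\<zero> \<ominus> c) \<in> I" by (rule a_inv_closed)
      moreover have "\<ominus> (\<zero> \<ominus> c) = c" using c by algebra
      ultimately show ?thesis by simp
    qed
    then show "c \<in> carrier R \<inter> \<Inter>?A" using c by blast
  next
    fix c assume "c \<in> carrier R \<inter> \<Inter>?A"
    then have c: "c \<in> carrier R" "\<And>I. I \<in> ?A \<Longrightarrow> c \<in> I" by auto
    have sym: "(w, u) \<in> (step I)\<^sup>*" if "(u, w) \<in> (step I)\<^sup>*" for u w I
    proof -
      have "sym (step I)" by (auto simp: sym_def step_def insert_commute)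
      then show ?thesis using that sym_rtrancl by (metis symD)
    qed
    \<comment> \<open>\<open>f I\<close> is the value that the spline under construction has modulo \<open>I\<close>: the constant \<open>c\<close> on the
      \<open>I\<close>-component of \<open>v k\<close>, unless this component meets an earlier vertex and \<open>c\<close> is \<open>0\<close> modulo \<open>I\<close>.\<close>
    define f where "f = (\<lambda>I w. if (v k, w) \<in> (step I)\<^sup>* \<and> I \<notin> ?A then c else \<zero>)"
    have fR: "f I w \<in> carrier R" for I w using c by (simp add: f_def)
    \<comment> \<open>The congruences range over the set of labels, so equal labels on different
      edges count once and the remaining ones are comaximal.\<close>
    have "\<exists>x\<in>carrier R. \<forall>I\<in>\<alpha> ` E. x \<ominus> f I w \<in> I" for w
      using finite_E label_ideal comax fR
      by (intro chinese_remainder_family[where f = "\<lambda>I. f I w"]) auto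
    then obtain x where x: "\<And>w. x w \<in> carrier R" "\<And>w I. I \<in> \<alpha> ` E \<Longrightarrow> x w \<ominus> f I w \<in> I"
      by metis
    \<comment> \<open>The remainder theorem fixes values only modulo the labels, so the exact values
      at \<open>v k\<close> and at earlier vertices are imposed by hand; they must then be shown to
      have the prescribed residues.\<close>
    define s where "s = (\<lambda>w\<in>V. if w = v k then c else if w \<in> v ` {..<k} then \<zero> else x w)"
    have sR: "s w \<in> carrier R" if "w \<in> V" for w using that c x by (simp add: s_def)
    have s: "s w \<ominus> f I w \<in> I" if w: "w \<in> V" and I: "I \<in> \<alpha> ` E" for w I
    proof -
      interpret ideal I R using I label_ideal by blast
      consider "w = v k" | "w \<noteq> v k" "w \<in> v ` {..<k}" | "w \<noteq> v k" "w \<notin> v ` {..<k}" by blast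
      then show ?thesis
      proof cases
        case 1
        then show ?thesis
          \<comment> \<open>If \<open>I \<in> ?A\<close>, the residue is 0, and \<open>c\<close>
            lies in \<open>I\<close> by assumption; otherwise the residue is \<open>c\<close>
            itself.\<close>
          using w c by (cases "I \<in> ?A") (auto simp: s_def f_def a_minus_def r_neg)
      next
        case 2
        \<comment> \<open>If \<open>v k\<close> reaches the earlier vertex \<open>w\<close>,
          symmetry puts \<open>I\<close> into \<open>?A\<close>, which makes the residue 0.\<close>
        then have "f I w = \<zero>" using I sym by (auto simp: f_def)
        then show ?thesis using 2 w by (simp add: s_def a_minus_def)
      next
        case 3
        then show ?thesis using w x(2)[OF I] by (simp add: s_def)
      qed
    qed
    have "s u \<ominus> s w \<in> \<alpha> e" if e: "e \<in> E" "u \<in> V" "w \<in> V" "ends e = {u, w}" for e u w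
    proof -
      interpret ideal "\<alpha> e" R using e label_ideal by blast
      have "(u, w) \<in> step (\<alpha> e)" "(w, u) \<in> step (\<alpha> e)"
        using e by (auto simp: step_def insert_commute)
      then have "(v k, u) \<in> (step (\<alpha> e))\<^sup>* \<longleftrightarrow> (v k, w) \<in> (step (\<alpha> e))\<^sup>*"
        by (meson rtrancl.rtrancl_into_rtrancl)
      then have f: "f (\<alpha> e) w = f (\<alpha> e) u" by (simp add: f_def)
      \<comment> \<open>Both ends of the edge lie in the same component for its label, so their
        values are compared with one common residue.\<close>
      have "s u \<ominus> s w = (s u \<ominus> f (\<alpha> e) u) \<ominus> (s w \<ominus> f (\<alpha> e) u)"
        using sR e fR[of "\<alpha> e" u] by algebra
      moreover have "s u \<ominus> f (\<alpha> e) u \<in> \<alpha> e" "s w \<ominus> f (\<alpha> e) u \<in> \<alpha> e"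
        using s[of u "\<alpha> e"] s[of w "\<alpha> e"] e f by auto
      ultimately show ?thesis by (simp add: a_minus_def)
    qed
    moreover have "s \<in> V \<rightarrow>\<^sub>E carrier R" using sR by (auto simp: s_def)
    ultimately have "s \<in> carrier (splines R V E ends \<alpha>)" by (simp add: splines_def)
    moreover have "s (v j) = \<zero>" if "j < k" for j
    proof -
      have "v j \<noteq> v k" using enum that k by (auto simp: bij_betw_def inj_on_def)
      then show ?thesis using that k vV[of j] by (auto simp: s_def)
    qed
    moreover have "s (v k) = c" using vV[OF k] by (simp add: s_def)
    ultimately show "c \<in> ?L" by blast
  qed
qed

end

section \<open>Freeness and projectivity of the module of splines\<close>

lemma splines_free:
  assumes "domain R" "edge_labeled_graph R V E ends \<alpha>"
    and "\<And>I. I \<in> \<alpha> ` E \<Longrightarrow> principalideal I R"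
    and "\<And>I J. I \<in> \<alpha> ` E \<Longrightarrow> J \<in> \<alpha> ` E \<Longrightarrow> I \<noteq> J \<Longrightarrow> I <+>\<^bsub>R\<^esub> J = carrier R"
  shows "free_module R (splines R V E ends \<alpha>)"
proof -
  interpret edge_labeled_graph R V E ends \<alpha> by fact
  obtain v where v: "bij_betw v {..<card V} V"
    using ex_bij_betw_nat_finite[OF finite_V] by (auto simp: lessThan_atLeast0)
  have vV: "v j \<in> V" if "j < card V" for j using v that by (auto simp: bij_betw_def)
  show ?thesis
  \<comment> \<open>The coordinates are evaluations at the enumerated vertices; they are jointly
    injective because splines are extensional on \<open>V\<close>.\<close>
  proof (rule free_module_of_leading_ideals[where n = "card V" and \<phi> = "\<lambda>k s. s (v k)"])
    fix s assume s: "s \<in> carrier (splines R V E ends \<alpha>)"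
      and 0: "\<And>k. k < card V \<Longrightarrow> s (v k) = \<zero>\<^bsub>R\<^esub>"
    have "s w = \<zero>\<^bsub>R\<^esub>" if "w \<in> V" for w
      using that 0 bij_betw_imp_surj_on[OF v] by force
    then show "s = \<zero>\<^bsub>splines R V E ends \<alpha>\<^esub>"
      using s by (auto simp: splines_def fun_eq_iff PiE_iff extensional_def)
  next
    fix k assume k: "k < card V"
    have "\<exists>c\<in>carrier R. carrier R \<inter> \<Inter>{I \<in> \<alpha> ` E. \<exists>j<k. (v j, v k) \<in> (step I)\<^sup>*} = PIdl\<^bsub>R\<^esub> c"
      using finite_E assms(3,4) by (intro principalideal_Inter_comaximal) auto
    then show "\<exists>c\<in>carrier R. (\<lambda>s. s (v k)) `
        {s \<in> carrier (splines R V E ends \<alpha>). \<forall>j<k. s (v j) = \<zero>\<^bsub>R\<^esub>} = PIdl\<^bsub>R\<^esub> c"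
      by (subst leading_ideal[OF v k assms(4)])
  qed (use assms(1) splines_module vV in \<open>auto simp: splines_def PiE_iff\<close>)
qed

theorem proposition2:
  fixes R :: "('r, 'm) ring_scheme" (structure)
    and V :: "'v set" and E :: "'e set" and ends :: "'e \<Rightarrow> 'v set" and \<alpha> :: "'e \<Rightarrow> 'r set"
  assumes "noetherian_domain R"
    and "edge_labeled_graph R V E ends \<alpha>"
    and "\<forall>e\<in>E. principalideal (\<alpha> e) R"
    and "\<forall>I\<in>\<alpha> ` E. \<forall>J\<in>\<alpha> ` E. I \<noteq> J \<longrightarrow> I <+>\<^bsub>R\<^esub> J = carrier R"
  shows "projective_module R (splines R V E ends \<alpha>) \<and>
    (principal_domain R \<or>
      (\<exists>(A :: 'a ring) n. (principal_domain A \<or> field A) \<and> R \<simeq> indexed_poly_ring A n) \<longrightarrow>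
     free_module R (splines R V E ends \<alpha>))"
proof -
  have "domain R" using assms(1) by (simp add: noetherian_domain_def)
  then have "free_module R (splines R V E ends \<alpha>)"
    using assms(2-4) by (intro splines_free) auto
  then show ?thesis using free_imp_projective by blast
qed

end
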